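(* Let $(X,d)$ be a complete length space and let $T>0$. Assume that $u_0:X\to\mathbb{R}$ is bounded and Lipschitz. Assume in addition that $f\in C(X\times(0,T))$ is bounded and that $f(x,t)$ is Lipschitz with respect to either $x$ or $t$, i.e. there is $L_f>0$ such that either $|f(x,t)-f(y,t)|\le L_f\,d(x,y)$ for all $x,y\in X$, $t\in(0,T)$, or $|f(x,t)-f(x,s)|\le L_f|t-s|$ for all $x\in X$, $t,s\in(0,T)$. Then there exists a unique bounded Monge solution $u\in \mathrm{Lip}(X\times[0,T))$ of $$\partial_t u+|\nabla u|=f(x,t)\quad\text{in } X\times(0,T)$$ satisfying the initial condition in the sense that $$\sup_{x\in X}|u(x,t)-u_0(x)|\to 0\quad\text{as } t\to0+ .$$
   Context: Write $Y_T=X\times(0,T)$; space-time is equipped with the metric $\bar d((x_1,t_1),(x_2,t_2))=\max\{d(x_1,x_2),|t_1-t_2|\}$. $\mathrm{Lip}(E)$ and $\mathrm{Lip}_{loc}(E)$ denote the sets of Lipschitz and locally Lipschitz real functions on $E$. For $k\ge0$, $$S_k(Y_T)=\{u\in \mathrm{Lip}_{loc}(Y_T): u(x,t)-u(x,s)\ge -k(t-s)\ \text{for all } x\in X,\ 0<s<t<T\},\qquad S(Y_T)=\bigcup_{k\ge0}S_k(Y_T).$$ For $v\in S_0(Y_T)$ and $(x,t)\in Y_T$, $$|D^-v|(x,t)=\limsup_{\delta\to0+}\ \sup\left\{\frac{v(x,t)-v(y,t-\delta)}{\delta}: y\in X,\ d(x,y)\le\delta\right\}.$$ Definition (Monge solution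 of $\partial_tu+|\nabla u|=f$): $u\in S(Y_T)$ is a Monge solution if there exists $k\ge0$ with $k+\inf_{Y_T}f\ge0$ and $u\in S_k(Y_T)$ such that $v(x,t)=u(x,t)+kt$ (which lies in $S_0(Y_T)$) satisfies $|D^-v|(x,t)=f(x,t)+k$ for every $(x,t)\in Y_T$. A function on $X\times[0,T)$ is called a Monge solution if its restriction to $Y_T$ is. *)

theory Defs
  imports "HOL-Analysis.Analysis"
begin

text \<open>A metric space is a carrier type of class \<open>metric_space\<close>, so \<open>X = UNIV\<close>. Functions on subsets of
  \<open>X \<times> \<real>\<close> are total functions on \<open>'a \<times> real\<close> whose values off the relevant set play no role.\<close>

definition curve_length :: "(real \<Rightarrow> 'a::metric_space) \<Rightarrow> ereal" where
  "curve_length g =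
     (SUP ts\<in>{ts. sorted ts \<and> set ts \<subseteq> {0..1}}.
        ereal (\<Sum>i<length ts - 1. dist (g (ts ! i)) (g (ts ! Suc i))))"

text \<open>The infimum over the empty set is \<open>\<infinity>\<close>, so the condition includes the existence of
  rectifiable curves joining any two points.\<close>

definition length_space :: "'a::metric_space itself \<Rightarrow> bool" where
  "length_space _ \<longleftrightarrow>
     (\<forall>x y :: 'a. ereal (dist x y) =
        (INF g\<in>{g. path g \<and> pathstart g = x \<and> pathfinish g = y}. curve_length g))"

text \<open>The space-time metric is the maximum metric; the library metric on products is the
  Euclidean combination, so \<open>lipschitz_on\<close> on the product type would refer to another metric.\<close>

definition st_dist :: "'a::metric_space \<times> real \<Rightarrow> 'a \<times> real \<Rightarrow> real" where
  "st_dist p q = max (dist (fst p) (fst q)) \<bar>snd p - snd q\<bar>"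

definition st_Lip :: "('a::metric_space \<times> real) set \<Rightarrow> ('a \<times> real \<Rightarrow> real) set" where
  "st_Lip E = {u. \<exists>L\<ge>0. \<forall>p\<in>E. \<forall>q\<in>E. \<bar>u p - u q\<bar> \<le> L * st_dist p q}"

definition st_Lip_loc :: "('a::metric_space \<times> real) set \<Rightarrow> ('a \<times> real \<Rightarrow> real) set" where
  "st_Lip_loc E = {u. \<forall>p\<in>E. \<exists>r>0. u \<in> st_Lip {q \<in> E. st_dist p q < r}}"

definition YT :: "real \<Rightarrow> ('a::metric_space \<times> real) set" where
  "YT T = UNIV \<times> {0<..<T}"

definition S_class :: "real \<Rightarrow> real \<Rightarrow> ('a::metric_space \<times> real \<Rightarrow> real) set" where
  "S_class T k =
     {u \<in> st_Lip_loc (YT T).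
        \<forall>x s t. 0 < s \<and> s < t \<and> t < T \<longrightarrow> u (x, t) - u (x, s) \<ge> - k * (t - s)}"

text \<open>For \<open>t > 0\<close> only \<open>\<delta> < t\<close> matters in the upper limit, hence only points of
  \<open>X \<times> {0<..t}\<close> are relevant. The value is extended real because for a fixed \<open>\<delta>\<close> the supremum
  over the ball may be infinite.\<close>

definition Dminus :: "('a::metric_space \<times> real \<Rightarrow> real) \<Rightarrow> 'a \<times> real \<Rightarrow> ereal" where
  "Dminus v = (\<lambda>(x, t).
     Limsup (at_right 0)
       (\<lambda>\<delta>. SUP y\<in>{y. dist x y \<le> \<delta>}. ereal ((v (x, t) - v (y, t - \<delta>)) / \<delta>)))"

text \<open>The membership \<open>u \<in> S_class T k\<close> with \<open>k \<ge> 0\<close> subsumes \<open>u \<in> S(Y\<^sub>T)\<close>.\<close>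

definition Monge_solution ::
    "real \<Rightarrow> ('a::metric_space \<times> real \<Rightarrow> real) \<Rightarrow> ('a \<times> real \<Rightarrow> real) \<Rightarrow> bool" where
  "Monge_solution T f u \<longleftrightarrow>
     (\<exists>k\<ge>0. 0 \<le> ereal k + (INF p\<in>YT T. ereal (f p)) \<and> u \<in> S_class T k \<and>
        (\<forall>p\<in>YT T. Dminus (\<lambda>(x, t). u (x, t) + k * t) p = ereal (f p + k)))"

end

theory Submission
  imports Defs
begin

text \<open>Adding \<open>k t\<close> to \<open>u\<close> adds \<open>k\<close> to every difference quotient in \<open>|D\<^sup>-u|\<close>, so for a Lipschitz
  function \<open>u\<close> being a Monge solution means exactly \<open>|D\<^sup>-u| = f\<close> at every point of \<open>X \<times> (0,T)\<close>, whatever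
  admissible \<open>k\<close> the definition picks (\<open>Monge_solution_iff_slope\<close>).

  Uniqueness. Let \<open>u\<close> and \<open>v\<close> be two solutions. The upper bound on the slope of \<open>u\<close> holds for all
  sufficiently small backward steps \<open>\<delta>\<close>, while the lower bound for \<open>v\<close> is attained for arbitrarily small
  \<open>\<delta>\<close>; hence from every point some backward step is good for both, and along it \<open>u - v\<close> does not
  decrease, up to an error \<open>2\<epsilon>\<delta>\<close>. Consecutive steps form a chain whose spatial displacement is at most the elapsed
  time, so completeness lets it be continued through limit points down to time 0
  (\<open>backward_descent_to_initial_time\<close>). There the two functions agree, and \<open>u \<le> v\<close> follows as
  \<open>\<epsilon> \<rightarrow> 0\<close> (\<open>Monge_comparison\<close>).

  Existence. The solution is the value function of the control problem in which a point moves with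
  speed at most one and pays the running cost \<open>f\<close>:
  \<open>u(x,t) = inf {u0(g 0) + \<integral>\<^sub>0\<^sup>t f(g s, s) ds}\<close> over 1-Lipschitz curves \<open>g\<close> with \<open>g t = x\<close>. Dynamic
  programming gives the slope identity: moving to \<open>x\<close> from any point in the backward cone costs about
  \<open>f(x,t) \<delta>\<close> (\<open>val_slope_le\<close>), and a nearly optimal curve shows that nothing cheaper is possible
  (\<open>val_slope_ge\<close>). The first half needs curves of speed one between given points; they exist in a
  complete length space because approximate midpoints can be inserted dyadically
  (\<open>lipschitz_curve_exists\<close>). The Lipschitz hypothesis on \<open>f\<close> makes \<open>u\<close> Lipschitz,
  through time shifts of curves (\<open>action_shift_le\<close>).\<close>

section \<open>The backward slope\<close>

text \<open>The inequalities \<open>|D\<^sup>-v|(p) \<le> c\<close> and \<open>|D\<^sup>-v|(p) \<ge> c\<close> without extended reals. The first holds for all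
  small steps, the second along some steps tending to 0; comparison rests on this asymmetry between
  the two bounds of an upper limit, because one step can then serve both.\<close>

definition slope_le :: "('a::metric_space \<times> real \<Rightarrow> real) \<Rightarrow> 'a \<times> real \<Rightarrow> real \<Rightarrow> bool" where
  "slope_le v p c \<longleftrightarrow>
     (\<forall>\<epsilon>>0. \<exists>r>0. \<forall>\<delta> y. 0 < \<delta> \<and> \<delta> < r \<and> dist (fst p) y \<le> \<delta> \<longrightarrow>
        v p - v (y, snd p - \<delta>) \<le> (c + \<epsilon>) * \<delta>)"

definition slope_ge :: "('a::metric_space \<times> real \<Rightarrow> real) \<Rightarrow> 'a \<times> real \<Rightarrow> real \<Rightarrow> bool" where
  "slope_ge v p c \<longleftrightarrow>
     (\<forall>\<epsilon>>0. \<forall>r>0. \<exists>\<delta> y. 0 < \<delta> \<and> \<delta> < r \<and> dist (fst p) y \<le> \<delta> \<and>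
        (c - \<epsilon>) * \<delta> \<le> v p - v (y, snd p - \<delta>))"

lemma Dminus_le_iff: "Dminus v p \<le> ereal c \<longleftrightarrow> slope_le v p c"
proof -
  obtain x t where p: "p = (x, t)" by (cases p)
  let ?S = "\<lambda>\<delta>. SUP y\<in>{y. dist x y \<le> \<delta>}. ereal ((v (x, t) - v (y, t - \<delta>)) / \<delta>)"
  have D: "Dminus v p = Limsup (at_right 0) ?S" by (simp add: Dminus_def p)
  show ?thesis
  proof
    assume L: "Dminus v p \<le> ereal c"
    show "slope_le v p c"
      unfolding slope_le_def
    proof (intro allI impI)
      fix \<epsilon> :: real assume "\<epsilon> > 0"
      then have "\<forall>\<^sub>F \<delta> in at_right 0. ?S \<delta> < ereal (c + \<epsilon>)"
        using L unfolding D Limsup_le_iff by simp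
      then obtain r where r: "r > 0" "\<And>\<delta>. 0 < \<delta> \<Longrightarrow> \<delta> < r \<Longrightarrow> ?S \<delta> < ereal (c + \<epsilon>)"
        unfolding eventually_at_right_field by auto
      have "v p - v (y, snd p - \<delta>) \<le> (c + \<epsilon>) * \<delta>"
        if "0 < \<delta>" "\<delta> < r" "dist (fst p) y \<le> \<delta>" for \<delta> y
      proof -
        have "ereal ((v (x, t) - v (y, t - \<delta>)) / \<delta>) \<le> ?S \<delta>"
          using that by (intro SUP_upper) (auto simp: p)
        also have "\<dots> < ereal (c + \<epsilon>)" using r that by auto
        finally show ?thesis using that by (simp add: p pos_divide_less_eq)
      qed
      then show "\<exists>r>0. \<forall>\<delta> y. 0 < \<delta> \<and> \<delta> < r \<and> dist (fst p) y \<le> \<delta> \<longrightarrow>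
          v p - v (y, snd p - \<delta>) \<le> (c + \<epsilon>) * \<delta>"
        using r(1) by blast
    qed
  next
    assume S: "slope_le v p c"
    show "Dminus v p \<le> ereal c"
      unfolding D Limsup_le_iff
    proof (intro allI impI)
      fix z assume "ereal c < z"
      then obtain b where b: "c < b" "ereal b < z"
        using ereal_dense2 by force
      then obtain r where r: "r > 0" "\<And>\<delta> y. 0 < \<delta> \<Longrightarrow> \<delta> < r \<Longrightarrow> dist x y \<le> \<delta> \<Longrightarrow>
          v (x, t) - v (y, t - \<delta>) \<le> b * \<delta>"
        using S[unfolded slope_le_def, rule_format, of "b - c"] by (auto simp: p)
      have "?S \<delta> < z" if "0 < \<delta>" "\<delta> < r" for \<delta>
      proof -
        have "?S \<delta> \<le> ereal b"
          using r that by (intro SUP_least) (auto simp: pos_divide_le_eq)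
        then show ?thesis using b by auto
      qed
      then show "\<forall>\<^sub>F \<delta> in at_right 0. ?S \<delta> < z"
        unfolding eventually_at_right_field using r(1) by blast
    qed
  qed
qed

lemma Dminus_ge_iff: "ereal c \<le> Dminus v p \<longleftrightarrow> slope_ge v p c"
proof -
  obtain x t where p: "p = (x, t)" by (cases p)
  let ?S = "\<lambda>\<delta>. SUP y\<in>{y. dist x y \<le> \<delta>}. ereal ((v (x, t) - v (y, t - \<delta>)) / \<delta>)"
  have D: "Dminus v p = Limsup (at_right 0) ?S" by (simp add: Dminus_def p)
  show ?thesis
  proof
    assume L: "ereal c \<le> Dminus v p"
    show "slope_ge v p c"
    proof (rule ccontr)
      assume "\<not> slope_ge v p c"
      then obtain \<epsilon> r where er: "\<epsilon> > 0" "r > 0"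
        and less: "\<And>\<delta> y. 0 < \<delta> \<Longrightarrow> \<delta> < r \<Longrightarrow> dist x y \<le> \<delta> \<Longrightarrow>
          v (x, t) - v (y, t - \<delta>) < (c - \<epsilon>) * \<delta>"
        unfolding slope_ge_def p by (force simp: not_le)
      have "?S \<delta> \<le> ereal (c - \<epsilon>)" if "0 < \<delta>" "\<delta> < r" for \<delta>
        using less that by (intro SUP_least) (auto simp: pos_divide_le_eq less_imp_le)
      then have "\<forall>\<^sub>F \<delta> in at_right 0. ?S \<delta> \<le> ereal (c - \<epsilon>)"
        unfolding eventually_at_right_field using er by blast
      then have "Dminus v p \<le> ereal (c - \<epsilon>)"
        unfolding D by (rule Limsup_bounded)
      then have "ereal c \<le> ereal (c - \<epsilon>)" using L by (rule order_trans[rotated])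
      then show False using er by simp
    qed
  next
    assume S: "slope_ge v p c"
    show "ereal c \<le> Dminus v p"
    proof (rule ccontr)
      assume "\<not> ereal c \<le> Dminus v p"
      then obtain b where b: "Dminus v p < ereal b" "b < c"
        using ereal_dense2[of "Dminus v p" "ereal c"] by (auto simp: not_le)
      then have "\<forall>\<^sub>F \<delta> in at_right 0. ?S \<delta> < ereal b"
        unfolding D by (intro Limsup_lessD)
      then obtain r where r: "r > 0" "\<And>\<delta>. 0 < \<delta> \<Longrightarrow> \<delta> < r \<Longrightarrow> ?S \<delta> < ereal b"
        unfolding eventually_at_right_field by auto
      obtain \<delta> y where \<delta>: "0 < \<delta>" "\<delta> < r" "dist x y \<le> \<delta>"
        "b * \<delta> \<le> v (x, t) - v (y, t - \<delta>)"
        using S[unfolded slope_ge_def, rule_format, of "c - b" r] b r by (auto simp: p)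
      have "ereal b \<le> ereal ((v (x, t) - v (y, t - \<delta>)) / \<delta>)"
        using \<delta> by (simp add: pos_le_divide_eq)
      also have "\<dots> \<le> ?S \<delta>" using \<delta> by (intro SUP_upper) auto
      also have "\<dots> < ereal b" using r \<delta> by auto
      finally show False by simp
    qed
  qed
qed

lemma slope_add_time:
  "slope_le (\<lambda>(x, t). u (x, t) + k * t) p (c + k) \<longleftrightarrow> slope_le u p c"
  "slope_ge (\<lambda>(x, t). u (x, t) + k * t) p (c + k) \<longleftrightarrow> slope_ge u p c"
proof -
  obtain x t where p: "p = (x, t)" by (cases p)
  have *: "u (x, t) + k * t - (u (y, t - \<delta>) + k * (t - \<delta>)) = u (x, t) - u (y, t - \<delta>) + k * \<delta>"
    "(c + k + \<epsilon>) * \<delta> = (c + \<epsilon>) * \<delta> + k * \<delta>" "(c + k - \<epsilon>) * \<delta> = (c - \<epsilon>) * \<delta> + k * \<delta>" for y \<delta> \<epsilon>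
    by (auto simp: algebra_simps)
  show "slope_le (\<lambda>(x, t). u (x, t) + k * t) p (c + k) \<longleftrightarrow> slope_le u p c"
    "slope_ge (\<lambda>(x, t). u (x, t) + k * t) p (c + k) \<longleftrightarrow> slope_ge u p c"
    unfolding slope_le_def slope_ge_def p by (simp_all add: *)
qed

lemma Dminus_add_time_eq_iff:
  "Dminus (\<lambda>(x, t). u (x, t) + k * t) p = ereal (c + k) \<longleftrightarrow> slope_le u p c \<and> slope_ge u p c"
  using Dminus_le_iff[of "\<lambda>(x, t). u (x, t) + k * t" p "c + k"]
    Dminus_ge_iff[of "c + k" "\<lambda>(x, t). u (x, t) + k * t" p]
  unfolding slope_add_time by (auto intro: antisym)

text \<open>Only times slightly before \<open>t\<close> matter, so the value function may be cut off outside
  \<open>[0,T)\<close> without changing its slope.\<close>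

lemma slope_cong:
  fixes u v :: "'a::metric_space \<times> real \<Rightarrow> real"
  assumes r: "0 < r" and eq: "\<And>y s. t - r < s \<Longrightarrow> s \<le> t \<Longrightarrow> u (y, s) = v (y, s)"
  shows "slope_le u (x, t) c = slope_le v (x, t) c"
    and "slope_ge u (x, t) c = slope_ge v (x, t) c"
proof -
  have le: "slope_le v (x, t) c"
    if eq: "\<And>y s. t - r < s \<Longrightarrow> s \<le> t \<Longrightarrow> u (y, s) = v (y, s)" and u: "slope_le u (x, t) c"
    for u v :: "'a \<times> real \<Rightarrow> real"
    unfolding slope_le_def fst_conv snd_conv
  proof (intro allI impI)
    fix e :: real assume "0 < e"
    then obtain d where d: "0 < d" "\<And>\<delta> y. 0 < \<delta> \<Longrightarrow> \<delta> < d \<Longrightarrow> dist x y \<le> \<delta> \<Longrightarrow>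
        u (x, t) - u (y, t - \<delta>) \<le> (c + e) * \<delta>"
      using u[unfolded slope_le_def fst_conv snd_conv, rule_format, OF \<open>0 < e\<close>] by auto
    have "v (x, t) - v (y, t - \<delta>) \<le> (c + e) * \<delta>"
      if "0 < \<delta> \<and> \<delta> < min d r \<and> dist x y \<le> \<delta>" for \<delta> y
      using d(2)[of \<delta> y] that eq[of t x] eq[of "t - \<delta>" y] r by simp
    then show "\<exists>d>0. \<forall>\<delta> y. 0 < \<delta> \<and> \<delta> < d \<and> dist x y \<le> \<delta> \<longrightarrow>
        v (x, t) - v (y, t - \<delta>) \<le> (c + e) * \<delta>"
      using d(1) r by (intro exI[of _ "min d r"]) auto
  qed
  show "slope_le u (x, t) c = slope_le v (x, t) c"
    using le[of u v] le[of v u] eq by (auto 4 4)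
  have ge: "slope_ge v (x, t) c"
    if eq: "\<And>y s. t - r < s \<Longrightarrow> s \<le> t \<Longrightarrow> u (y, s) = v (y, s)" and u: "slope_ge u (x, t) c"
    for u v :: "'a \<times> real \<Rightarrow> real"
    unfolding slope_ge_def fst_conv snd_conv
  proof (intro allI impI)
    fix e d :: real assume "0 < e" "0 < d"
    then obtain \<delta> y where "0 < \<delta>" "\<delta> < min d r" "dist x y \<le> \<delta>"
        "(c - e) * \<delta> \<le> u (x, t) - u (y, t - \<delta>)"
      using u[unfolded slope_ge_def fst_conv snd_conv, rule_format, of e "min d r"] r by auto
    then show "\<exists>\<delta> y. 0 < \<delta> \<and> \<delta> < d \<and> dist x y \<le> \<delta> \<and>
        (c - e) * \<delta> \<le> v (x, t) - v (y, t - \<delta>)"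
      using eq[of t x] eq[of "t - \<delta>" y] r by (intro exI[of _ \<delta>] exI[of _ y]) auto
  qed
  show "slope_ge u (x, t) c = slope_ge v (x, t) c"
    using ge[of u v] ge[of v u] eq by (auto 4 4)
qed

section \<open>Comparison by backward descent\<close>

text \<open>A variant of Ekeland's principle. From each point one moves within the backward cone, without
  decreasing \<open>w\<close>, to a point that realises at least half of the decrease in time possible under these
  constraints. Times decrease, and distances are controlled by times, so the points converge;
  at a limit with positive time another step would lower the time by a fixed amount, which
  contradicts the choice of the steps.\<close>

lemma backward_descent_to_initial_time:
  fixes w :: "'a::complete_space \<times> real \<Rightarrow> real"
  assumes cont: "continuous_on (UNIV \<times> {0..<T}) w"
    and step: "\<And>x t. 0 < t \<Longrightarrow> t < T \<Longrightarrow>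
      \<exists>y s. 0 \<le> s \<and> s < t \<and> dist x y \<le> t - s \<and> w (x, t) \<le> w (y, s)"
    and t: "0 \<le> t" "t < T"
  shows "\<exists>y. w (x, t) \<le> w (y, 0)"
proof -
  define below where "below p q \<longleftrightarrow> 0 \<le> snd q \<and> snd q \<le> snd p \<and>
    dist (fst p) (fst q) \<le> snd p - snd q \<and> w p \<le> w q" for p q
  \<comment> \<open>The earliest time that can be reached from \<open>p\<close>.\<close>
  define \<sigma> where "\<sigma> p = Inf (snd ` {q. below p q})" for p
  have trans: "below p r" if "below p q" "below q r" for p q r
    using that dist_triangle[of "fst p" "fst r" "fst q"] by (auto simp: below_def)
  have refl: "below p p" if "0 \<le> snd p" for p
    using that by (auto simp: below_def)
  have bdd: "bdd_below (snd ` {q. below p q})" for p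
    by (rule bdd_belowI[of _ 0]) (auto simp: below_def)
  have \<sigma>_le: "\<sigma> p \<le> snd q" if "below p q" for p q
    unfolding \<sigma>_def using that bdd by (intro cInf_lower) auto
  have next_pt: "\<exists>q. below p q \<and> snd q \<le> (snd p + \<sigma> p) / 2" if "0 \<le> snd p" for p
  proof (cases "\<sigma> p < snd p")
    case True
    then have "Inf (snd ` {q. below p q}) < (snd p + \<sigma> p) / 2" by (simp add: \<sigma>_def)
    then have "\<exists>s\<in>snd ` {q. below p q}. s < (snd p + \<sigma> p) / 2"
      using refl[OF that] cInf_lessD[of "snd ` {q. below p q}"] by blast
    then show ?thesis by (auto intro: less_imp_le)
  next
    case False
    then show ?thesis using refl[OF that] by (intro exI[of _ p]) auto
  qed
  have "\<exists>P. \<forall>n. (below (x, t) (P n) \<and> (n = 0 \<longrightarrow> P n = (x, t))) \<and>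
      (below (P n) (P (Suc n)) \<and> snd (P (Suc n)) \<le> (snd (P n) + \<sigma> (P n)) / 2)"
  proof (rule dependent_nat_choice)
    show "\<exists>p. below (x, t) p \<and> (0 = (0::nat) \<longrightarrow> p = (x, t))"
      using refl t by auto
  next
    fix p n assume "below (x, t) p \<and> (n = (0::nat) \<longrightarrow> p = (x, t))"
    moreover from this have "0 \<le> snd p" by (auto simp: below_def)
    ultimately show "\<exists>q. (below (x, t) q \<and> (Suc n = 0 \<longrightarrow> q = (x, t))) \<and>
        below p q \<and> snd q \<le> (snd p + \<sigma> p) / 2"
      using next_pt[of p] trans by blast
  qed
  then obtain P where P: "\<And>n. below (x, t) (P n)" "\<And>n. below (P n) (P (Suc n))"
    "\<And>n. snd (P (Suc n)) \<le> (snd (P n) + \<sigma> (P n)) / 2" by blast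
  have nonneg: "0 \<le> snd (P n)" and less_T: "snd (P n) < T" for n
    using P(1)[of n] t by (auto simp: below_def)
  have chain: "below (P m) (P n)" if "m \<le> n" for m n
    using that by (induction n rule: dec_induct) (auto intro: refl nonneg trans P(2))
  have "decseq (\<lambda>n. snd (P n))"
    using chain by (auto simp: decseq_def below_def)
  then obtain s where s: "(\<lambda>n. snd (P n)) \<longlonglongrightarrow> s" "\<And>n. s \<le> snd (P n)"
    using decseq_convergent[of "\<lambda>n. snd (P n)" 0] nonneg by auto
  have s0: "0 \<le> s" using s(1) nonneg by (intro LIMSEQ_le_const) auto
  have sT: "s < T" using s(2)[of 0] less_T[of 0] by simp
  have "Cauchy (\<lambda>n. fst (P n))"
  proof (rule metric_CauchyI)
    fix e :: real assume "0 < e"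
    then obtain N where N: "\<And>m n. m \<ge> N \<Longrightarrow> n \<ge> N \<Longrightarrow> dist (snd (P m)) (snd (P n)) < e"
      using metric_CauchyD[OF LIMSEQ_imp_Cauchy[OF s(1)]] by blast
    have "dist (fst (P m)) (fst (P n)) \<le> dist (snd (P m)) (snd (P n))" for m n
    proof (cases "m \<le> n")
      case True then show ?thesis using chain[of m n] by (auto simp: below_def dist_real_def)
    next
      case False then show ?thesis using chain[of n m]
        by (auto simp: below_def dist_real_def dist_commute)
    qed
    then show "\<exists>N. \<forall>m\<ge>N. \<forall>n\<ge>N. dist (fst (P m)) (fst (P n)) < e"
      using N by (meson le_less_trans)
  qed
  then obtain y where y: "(\<lambda>n. fst (P n)) \<longlonglongrightarrow> y"
    using Cauchy_convergent convergent_def by blast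
  have "P \<longlonglongrightarrow> (y, s)"
    using tendsto_Pair[OF y s(1)] by simp
  then have wlim: "(\<lambda>n. w (P n)) \<longlonglongrightarrow> w (y, s)"
    using less_T nonneg s0 sT
    by (intro continuous_on_tendsto_compose[OF cont]) (auto simp: mem_Times_iff)
  have lim: "below (P m) (y, s)" for m
    unfolding below_def fst_conv snd_conv
  proof (intro conjI s0 s(2))
    show "dist (fst (P m)) y \<le> snd (P m) - s"
      by (rule LIMSEQ_le[OF tendsto_dist[OF tendsto_const y] tendsto_diff[OF tendsto_const s(1)]])
        (use chain[of m] in \<open>auto simp: below_def\<close>)
    show "w (P m) \<le> w (y, s)"
      by (rule LIMSEQ_le_const[OF wlim]) (use chain[of m] in \<open>auto simp: below_def\<close>)
  qed
  have "s = 0"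
  proof (rule ccontr)
    assume "s \<noteq> 0"
    then obtain z r where zr: "0 \<le> r" "r < s" "dist y z \<le> s - r" "w (y, s) \<le> w (z, r)"
      using step[of s y] s0 sT by auto
    then have "below (y, s) (z, r)" by (auto simp: below_def)
    \<comment> \<open>The point \<open>(z, r)\<close> stays reachable from every \<open>P n\<close>, so each step should have gone halfway to \<open>r\<close>.\<close>
    then have \<sigma>_r: "\<sigma> (P n) \<le> r" for n using \<sigma>_le[OF trans[OF lim], of "(z, r)"] by simp
    have "snd (P (Suc n)) \<le> (snd (P n) + r) / 2" for n
      using P(3)[of n] \<sigma>_r[of n] by simp
    then have "s \<le> (s + r) / 2"
      by (intro LIMSEQ_le[OF LIMSEQ_Suc[OF s(1)]
            tendsto_divide[OF tendsto_add[OF s(1) tendsto_const] tendsto_const]]) auto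
    then show False using zr by simp
  qed
  moreover have "below (x, t) (y, s)" using trans[OF P(1) lim] .
  ultimately show ?thesis by (auto simp: below_def)
qed

text \<open>The penalty \<open>2\<epsilon>t\<close> absorbs the errors \<open>\<epsilon>\<delta>\<close> of the two slope inequalities, so the penalised
  difference does not decrease along a common backward step. The common step exists because \<open>v\<close>
  offers admissible steps below every threshold, in particular below the one that \<open>u\<close> requires.\<close>

theorem Monge_comparison:
  fixes u v :: "'a::complete_space \<times> real \<Rightarrow> real" and f :: "'a \<times> real \<Rightarrow> real"
  assumes cont: "continuous_on (UNIV \<times> {0..<T}) u" "continuous_on (UNIV \<times> {0..<T}) v"
    and sub: "\<And>p. p \<in> YT T \<Longrightarrow> slope_le u p (f p)"
    and super: "\<And>p. p \<in> YT T \<Longrightarrow> slope_ge v p (f p)"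
    and init: "\<And>x. u (x, 0) \<le> v (x, 0)"
    and t: "0 \<le> t" "t < T"
  shows "u (x, t) \<le> v (x, t)"
proof -
  have approx: "u (x, t) - v (x, t) \<le> 2 * \<epsilon> * t" if eps: "\<epsilon> > 0" for \<epsilon>
  proof -
    define w where "w = (\<lambda>p. u p - v p - 2 * \<epsilon> * snd p)"
    have "\<exists>y. w (x, t) \<le> w (y, 0)"
    proof (rule backward_descent_to_initial_time[OF _ _ t])
      show "continuous_on (UNIV \<times> {0..<T}) w"
        unfolding w_def by (intro continuous_intros cont)
    next
      fix x :: 'a and t :: real assume t: "0 < t" "t < T"
      then have p: "(x, t) \<in> YT T" by (simp add: YT_def)
      obtain r where r: "r > 0" "\<And>\<delta> y. 0 < \<delta> \<Longrightarrow> \<delta> < r \<Longrightarrow> dist x y \<le> \<delta> \<Longrightarrow>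
          u (x, t) - u (y, t - \<delta>) \<le> (f (x, t) + \<epsilon>) * \<delta>"
        using sub[OF p, unfolded slope_le_def, rule_format, OF eps] by (auto simp only: fst_conv snd_conv)
      obtain \<delta> y where \<delta>: "0 < \<delta>" "\<delta> < min r t" "dist x y \<le> \<delta>"
        "(f (x, t) - \<epsilon>) * \<delta> \<le> v (x, t) - v (y, t - \<delta>)"
        using super[OF p, unfolded slope_ge_def, rule_format, of \<epsilon> "min r t"] eps r t by auto
      have "w (x, t) \<le> w (y, t - \<delta>)"
        using r(2)[of \<delta> y] \<delta> by (simp add: w_def algebra_simps)
      then show "\<exists>y s. 0 \<le> s \<and> s < t \<and> dist x y \<le> t - s \<and> w (x, t) \<le> w (y, s)"
        using \<delta> by (intro exI[of _ y] exI[of _ "t - \<delta>"]) auto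
    qed
    then obtain y where "w (x, t) \<le> w (y, 0)" ..
    then show ?thesis using init[of y] by (simp add: w_def)
  qed
  have "u (x, t) - v (x, t) \<le> 0 + e" if "e > 0" for e
  proof -
    have "u (x, t) - v (x, t) \<le> 2 * (e / (2 * (t + 1))) * t"
      by (rule approx) (use that t in simp)
    also have "\<dots> = e * (t / (t + 1))" using t by (simp add: divide_simps)
    also have "\<dots> \<le> e * 1" using that t by (intro mult_left_mono) auto
    finally show ?thesis by simp
  qed
  then show ?thesis using field_le_epsilon[of "u (x, t) - v (x, t)" 0] by simp
qed

section \<open>Curves of speed at most one\<close>

text \<open>On a curve from \<open>x\<close> to \<open>y\<close> of length below \<open>l\<close>, the intermediate value theorem gives a point at the same
  distance from both ends; the two equal distances sum to at most the length.\<close>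

lemma length_space_midpoint:
  fixes x y :: "'a::metric_space"
  assumes "length_space TYPE('a)" and "dist x y < l"
  shows "\<exists>m. dist x m < l / 2 \<and> dist m y < l / 2"
proof -
  have "(INF g\<in>{g. path g \<and> pathstart g = x \<and> pathfinish g = y}. curve_length g) < ereal l"
    using assms unfolding length_space_def by (metis less_ereal.simps(1))
  then obtain g where g: "path g" "g 0 = x" "g 1 = y" "curve_length g < ereal l"
    by (auto simp: INF_less_iff pathstart_def pathfinish_def)
  have "continuous_on {0..1} (\<lambda>s. dist x (g s) - dist (g s) y)"
    using g(1) unfolding path_def by (intro continuous_intros)
  then obtain s where s: "0 \<le> s" "s \<le> 1" "dist x (g s) - dist (g s) y = 0"
    using IVT'[of "\<lambda>s. dist x (g s) - dist (g s) y" 0 0 1] g by auto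
  have "ereal (\<Sum>i<length [0, s, 1] - 1. dist (g ([0, s, 1] ! i)) (g ([0, s, 1] ! Suc i)))
      \<le> curve_length g"
    unfolding curve_length_def by (rule SUP_upper) (use s in auto)
  then have "ereal (dist x (g s) + dist (g s) y) \<le> curve_length g"
    using g by (simp add: numeral_2_eq_2)
  then have "dist x (g s) + dist (g s) y < l"
    using g(4) by (metis le_less_trans less_ereal.simps(1))
  then show ?thesis using s(3) by (intro exI[of _ "g s"]) auto
qed

lemma dist_chain_le:
  fixes c :: "nat \<Rightarrow> 'a::metric_space"
  assumes "\<And>k. dist (c k) (c (Suc k)) \<le> e" "i \<le> j"
  shows "dist (c i) (c j) \<le> e * real (j - i)"
  using assms(2)
proof (induction j rule: dec_induct)
  case (step n)
  then show ?case
    using dist_triangle[of "c i" "c (Suc n)" "c n"] assms(1)[of n]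
    by (simp add: Suc_diff_le algebra_simps)
qed simp

text \<open>The curve is built from midpoints instead of reparametrising a rectifiable curve by arc length.
  Strictness of \<open>dist x y < l\<close> is what allows the refinement to continue: consecutive points on level
  \<open>n\<close> are at distance below \<open>l / 2 ^ n\<close>, hence have a midpoint again. The curve is the pointwise limit
  of the resulting step functions.\<close>

lemma lipschitz_curve_exists:
  fixes x y :: "'a::complete_space"
  assumes len: "length_space TYPE('a)" and xy: "dist x y < l"
  shows "\<exists>g. 1-lipschitz_on UNIV g \<and> g a = x \<and> g (a + l) = y"
proof -
  have l: "l > 0" using xy zero_le_dist[of x y] by linarith
  have "\<exists>D. \<forall>n. ((\<forall>k. dist (D n k) (D n (Suc k)) < l / 2 ^ n) \<and> D n 0 = x \<and> D n (2 ^ n) = y) \<and>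
      (\<forall>k. D (Suc n) (2 * k) = D n k)"
  proof (rule dependent_nat_choice)
    \<comment> \<open>The chain is continued constantly beyond its last point, which spares all index bounds.\<close>
    show "\<exists>c. (\<forall>k. dist (c k) (c (Suc k)) < l / 2 ^ 0) \<and> c 0 = x \<and> c (2 ^ 0) = y"
      using xy l by (intro exI[of _ "\<lambda>k. if k = 0 then x else y"]) auto
  next
    fix c :: "nat \<Rightarrow> 'a" and n :: nat
    assume c: "(\<forall>k. dist (c k) (c (Suc k)) < l / 2 ^ n) \<and> c 0 = x \<and> c (2 ^ n) = y"
    then have "\<forall>k. \<exists>m. dist (c k) m < l / 2 ^ n / 2 \<and> dist m (c (Suc k)) < l / 2 ^ n / 2"
      using length_space_midpoint[OF len] by blast
    then obtain m where m: "\<And>k. dist (c k) (m k) < l / 2 ^ n / 2"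
      "\<And>k. dist (m k) (c (Suc k)) < l / 2 ^ n / 2" by metis
    define c' where "c' k = (if even k then c (k div 2) else m (k div 2))" for k
    have "dist (c' k) (c' (Suc k)) < l / 2 ^ Suc n" for k
      using m[of "k div 2"] by (auto simp: c'_def elim!: oddE evenE)
    then show "\<exists>c'. ((\<forall>k. dist (c' k) (c' (Suc k)) < l / 2 ^ Suc n) \<and> c' 0 = x \<and>
        c' (2 ^ Suc n) = y) \<and> (\<forall>k. c' (2 * k) = c k)"
      using c by (intro exI[of _ c']) (auto simp: c'_def)
  qed
  then obtain D where step: "\<And>n k. dist (D n k) (D n (Suc k)) \<le> l / 2 ^ n"
    and D0: "\<And>n. D n 0 = x" and D1: "\<And>n. D n (2 ^ n) = y"
    and refine: "\<And>n k. D (Suc n) (2 * k) = D n k"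
    by (metis less_imp_le)
  define N where "N n s = nat \<lfloor>2 ^ n * s\<rfloor>" for n :: nat and s :: real
  have N_double: "N (Suc n) s = 2 * N n s \<or> N (Suc n) s = Suc (2 * N n s)" for n s
  proof -
    have "\<lfloor>2 * z\<rfloor> = 2 * \<lfloor>z\<rfloor> \<or> \<lfloor>2 * z\<rfloor> = 2 * \<lfloor>z\<rfloor> + 1" for z :: real
      by linarith
    from this[of "2 ^ n * s"] show ?thesis
      unfolding N_def by (auto simp: mult.assoc nat_mult_distrib nat_add_distrib) linarith
  qed
  have half: "(\<lambda>n. l / 2 ^ n) \<longlonglongrightarrow> 0"
    using tendsto_mult[OF tendsto_const LIMSEQ_realpow_zero[of "1 / 2 :: real"], of l]
    by (simp add: power_divide)
  have consec: "dist (D n (N n s)) (D (Suc n) (N (Suc n) s)) \<le> l / 2 ^ Suc n" for n s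
    using N_double[of n s] step[of "Suc n" "2 * N n s"] l by (auto simp: refine)
  have conv: "\<exists>z. (\<lambda>n. D n (N n s)) \<longlonglongrightarrow> z" for s
  proof -
    have tele: "dist (D m (N m s)) (D n (N n s)) \<le> l / 2 ^ m - l / 2 ^ n" if "m \<le> n" for m n
      using that
    proof (induction n rule: dec_induct)
      case (step n)
      have "l / 2 ^ n = l / 2 ^ Suc n + l / 2 ^ Suc n" by simp
      then show ?case
        using step.IH consec[of n s]
          dist_triangle[of "D m (N m s)" "D (Suc n) (N (Suc n) s)" "D n (N n s)"] by linarith
    qed simp
    have "Cauchy (\<lambda>n. D n (N n s))"
    proof (rule CauchyI')
      fix e :: real assume "e > 0"
      then obtain m0 where m0: "\<And>m. m \<ge> m0 \<Longrightarrow> l / 2 ^ m < e"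
        using half l unfolding LIMSEQ_iff by fastforce
      have "dist (D m (N m s)) (D n (N n s)) < e" if "m0 \<le> m" "m < n" for m n
      proof -
        have "0 < l / 2 ^ n" using l by simp
        then show ?thesis using tele[of m n] m0[of m] that by linarith
      qed
      then show "\<exists>M. \<forall>m\<ge>M. \<forall>n>m. dist (D m (N m s)) (D n (N n s)) < e" by blast
    qed
    then show ?thesis using Cauchy_convergent convergent_def by blast
  qed
  define G where "G s = lim (\<lambda>n. D n (N n s))" for s
  have G: "(\<lambda>n. D n (N n s)) \<longlonglongrightarrow> G s" for s
    using conv[of s] unfolding G_def by (simp add: convergent_LIMSEQ_iff[symmetric] convergent_def)
  have G_lip: "dist (G r) (G s) \<le> l * (s - r)" if "r \<le> s" for r s
  proof (rule LIMSEQ_le)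
    show "(\<lambda>n. dist (D n (N n r)) (D n (N n s))) \<longlonglongrightarrow> dist (G r) (G s)"
      by (intro tendsto_dist G)
    show "(\<lambda>n. l * (s - r) + l / 2 ^ n) \<longlonglongrightarrow> l * (s - r)"
      using tendsto_add[OF tendsto_const half] by simp
    have "dist (D n (N n r)) (D n (N n s)) \<le> l * (s - r) + l / 2 ^ n" for n
    proof -
      have "2 ^ n * r \<le> 2 ^ n * s" using that by simp
      then have le: "N n r \<le> N n s" unfolding N_def by (intro nat_mono floor_mono)
      have "real (N n s - N n r) \<le> 2 ^ n * s - 2 ^ n * r + 1"
        using \<open>2 ^ n * r \<le> 2 ^ n * s\<close> unfolding N_def by linarith
      then have "l / 2 ^ n * real (N n s - N n r) \<le> l / 2 ^ n * (2 ^ n * s - 2 ^ n * r + 1)"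
        using l by (intro mult_left_mono) auto
      also have "\<dots> = l * (s - r) + l / 2 ^ n" by (simp add: field_simps)
      finally show ?thesis using dist_chain_le[of "D n", OF step le] by linarith
    qed
    then show "\<exists>N0. \<forall>n\<ge>N0. dist (D n (N n r)) (D n (N n s)) \<le> l * (s - r) + l / 2 ^ n" by blast
  qed
  define g where "g s = G ((s - a) / l)" for s
  have "1-lipschitz_on UNIV g"
  proof (rule lipschitz_on_leI)
    fix r s :: real assume "r \<le> s"
    then have "dist (g r) (g s) \<le> l * ((s - a) / l - (r - a) / l)"
      unfolding g_def using l by (intro G_lip) (simp add: divide_right_mono)
    also have "\<dots> = s - r" using l by (simp add: field_simps)
    finally show "dist (g r) (g s) \<le> 1 * dist r s" using \<open>r \<le> s\<close> by (simp add: dist_real_def)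
  qed simp
  moreover have "g a = x"
    using LIMSEQ_unique[OF G[of 0]] D0 by (simp add: g_def N_def)
  moreover have "g (a + l) = y"
  proof -
    have "N n 1 = 2 ^ n" for n
      unfolding N_def by (metis floor_of_nat mult.right_neutral nat_int of_nat_numeral of_nat_power)
    then show ?thesis
      using LIMSEQ_unique[OF G[of 1]] D1 l by (simp add: g_def)
  qed
  ultimately show ?thesis by blast
qed

lemma lipschitz_curve_concat:
  fixes g h :: "real \<Rightarrow> 'a::metric_space"
  assumes g: "1-lipschitz_on UNIV g" and h: "1-lipschitz_on UNIV h" and eq: "g s = h s"
  shows "1-lipschitz_on UNIV (\<lambda>r. if r \<le> s then g r else h r)"
proof (rule lipschitz_on_leI)
  fix a b :: real assume "a \<le> b"
  have "dist (g a) (h b) \<le> dist a b" if "a \<le> s" "s < b"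
    using lipschitz_onD[OF g, of a s] lipschitz_onD[OF h, of s b] that eq
      dist_triangle[of "g a" "h b" "g s"] by (simp add: dist_real_def)
  then show "dist (if a \<le> s then g a else h a) (if b \<le> s then g b else h b) \<le> 1 * dist a b"
    using lipschitz_onD[OF g, of a b] lipschitz_onD[OF h, of a b] \<open>a \<le> b\<close> by auto
qed simp

lemma lipschitz_curve_shift:
  fixes g :: "real \<Rightarrow> 'a::metric_space"
  assumes "1-lipschitz_on UNIV g"
  shows "1-lipschitz_on UNIV (\<lambda>s. g (s + h))"
proof (rule lipschitz_onI)
  fix a b show "dist (g (a + h)) (g (b + h)) \<le> 1 * dist a b"
    using lipschitz_onD[OF assms, of "a + h" "b + h"] by (simp add: dist_real_def)
qed simp

section \<open>The value function\<close>

text \<open>The endpoints are excluded because two running costs are compared through the regularity of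
  \<open>f\<close>, which is known at times strictly between 0 and \<open>T\<close>, while integration starts at 0.\<close>

lemma integral_diff_le_of_open_bound:
  fixes F G :: "real \<Rightarrow> real"
  assumes F: "F integrable_on {a..b}" and G: "G integrable_on {a..b}" and ab: "a \<le> b"
    and le: "\<And>s. a < s \<Longrightarrow> s < b \<Longrightarrow> F s \<le> G s + K"
  shows "integral {a..b} F \<le> integral {a..b} G + K * (b - a)"
proof -
  have "integral {a<..<b} F \<le> integral {a<..<b} (\<lambda>s. G s + K)"
    using F G le by (intro integral_le) (auto simp: integrable_on_open_interval_real intro: integrable_add)
  then have "integral {a..b} F \<le> integral {a..b} (\<lambda>s. G s + K)"
    by (simp add: integral_open_interval_real)
  also have "\<dots> = integral {a..b} G + K * (b - a)"
    using G ab by (subst integral_add) auto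
  finally show ?thesis .
qed

locale eikonal_problem =
  fixes u0 :: "'a::complete_space \<Rightarrow> real" and f :: "'a \<times> real \<Rightarrow> real"
    and T B L0 M Lf :: real
  assumes length: "length_space TYPE('a)"
    and T_pos: "0 < T"
    and u0_bound: "\<And>x. \<bar>u0 x\<bar> \<le> B"
    and u0_lipschitz: "L0-lipschitz_on UNIV u0"
    and f_cont: "continuous_on (UNIV \<times> {0<..<T}) f"
    and f_bound: "\<And>x t. 0 < t \<Longrightarrow> t < T \<Longrightarrow> \<bar>f (x, t)\<bar> \<le> M"
    and Lf_nonneg: "0 \<le> Lf"
    and f_lipschitz:
      "(\<forall>x y. \<forall>t\<in>{0<..<T}. \<bar>f (x, t) - f (y, t)\<bar> \<le> Lf * dist x y) \<or>
       (\<forall>x. \<forall>t\<in>{0<..<T}. \<forall>s\<in>{0<..<T}. \<bar>f (x, t) - f (x, s)\<bar> \<le> Lf * \<bar>t - s\<bar>)"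
begin

abbreviation curve :: "(real \<Rightarrow> 'a) \<Rightarrow> bool" where
  "curve g \<equiv> 1-lipschitz_on UNIV g"

text \<open>Continuity of \<open>f\<close> is known on the open time interval only, and \<open>f\<close> need not extend continuously to time
  0. Replacing it by 0 elsewhere makes the running cost bounded and Borel along every curve.\<close>

definition rate :: "(real \<Rightarrow> 'a) \<Rightarrow> real \<Rightarrow> real" where
  "rate g s = (if 0 < s \<and> s < T then f (g s, s) else 0)"

definition action :: "(real \<Rightarrow> 'a) \<Rightarrow> real \<Rightarrow> real \<Rightarrow> real" where
  "action g a b = integral {a..b} (rate g)"

definition cost :: "(real \<Rightarrow> 'a) \<Rightarrow> real \<Rightarrow> real" where
  "cost g t = u0 (g 0) + action g 0 t"

definition val :: "'a \<Rightarrow> real \<Rightarrow> real" where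
  "val x t = (INF g\<in>{g. curve g \<and> g t = x}. cost g t)"

lemma M_nonneg: "0 \<le> M"
  using f_bound[of "T / 2" undefined] T_pos by auto

lemma L0_nonneg: "0 \<le> L0"
  using u0_lipschitz by (rule lipschitz_on_nonneg)

lemma curve_const: "curve (\<lambda>s. x)"
  by (rule lipschitz_onI) auto

lemma curve_dist_le: "curve g \<Longrightarrow> dist (g a) (g b) \<le> \<bar>a - b\<bar>"
  using lipschitz_onD[of 1 UNIV g a b] by (simp add: dist_real_def)

lemma u0_le: "dist x y \<le> h \<Longrightarrow> u0 x \<le> u0 y + L0 * h"
  using lipschitz_onD[OF u0_lipschitz, of x y] mult_left_mono[OF _ L0_nonneg, of "dist x y" h]
  by (simp add: dist_real_def abs_le_iff)

lemma rate_bound: "\<bar>rate g s\<bar> \<le> M"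
  using f_bound M_nonneg by (auto simp: rate_def)

lemma rate_integrable:
  assumes "curve g"
  shows "rate g integrable_on {a..b}"
proof -
  have "continuous_on {0<..<T} g"
    using lipschitz_on_continuous_on[OF assms] continuous_on_subset by blast
  then have "continuous_on {0<..<T} (\<lambda>s. f (g s, s))"
    by (intro continuous_on_compose2[OF f_cont] continuous_intros) auto
  then have "(\<lambda>s. indicator {0<..<T} s *\<^sub>R f (g s, s)) \<in> borel_measurable borel"
    by (intro borel_measurable_continuous_on_indicator) auto
  also have "(\<lambda>s. indicator {0<..<T} s *\<^sub>R f (g s, s)) = rate g"
    by (auto simp: rate_def fun_eq_iff)
  finally have "rate g \<in> borel_measurable lebesgue"
    by (intro measurable_completion) simp
  then have "rate g \<in> borel_measurable (lebesgue_on {a..b})"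
    by (rule measurable_restrict_space1)
  then show ?thesis
    by (rule measurable_bounded_by_integrable_imp_integrable[where g = "\<lambda>_. M"])
      (auto simp: rate_bound)
qed

lemma action_le:
  assumes "curve g" "a \<le> b" "\<And>s. a < s \<Longrightarrow> s < b \<Longrightarrow> rate g s \<le> c"
  shows "action g a b \<le> c * (b - a)"
proof -
  have "integral {a..b} (rate g) \<le> integral {a..b} (\<lambda>_. 0) + c * (b - a)"
    using assms by (intro integral_diff_le_of_open_bound rate_integrable integrable_0) auto
  then show ?thesis by (simp add: action_def)
qed

lemma action_ge:
  assumes "curve g" "a \<le> b" "\<And>s. a < s \<Longrightarrow> s < b \<Longrightarrow> c \<le> rate g s"
  shows "c * (b - a) \<le> action g a b"
proof -
  have "integral {a..b} (\<lambda>_. 0) \<le> integral {a..b} (rate g) + (- c) * (b - a)"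
    using assms by (intro integral_diff_le_of_open_bound rate_integrable integrable_0) auto
  then show ?thesis by (simp add: action_def)
qed

lemma action_bounds:
  assumes "curve g" "a \<le> b"
  shows "action g a b \<le> M * (b - a)" "- M * (b - a) \<le> action g a b"
  using rate_bound[of g] assms
  by (auto intro!: action_le action_ge[where c = "- M", simplified] simp: abs_le_iff minus_le_iff)

lemma action_combine:
  "curve g \<Longrightarrow> a \<le> b \<Longrightarrow> b \<le> c \<Longrightarrow> action g a b + action g b c = action g a c"
  unfolding action_def by (intro Henstock_Kurzweil_Integration.integral_combine rate_integrable)

lemma action_cong:
  "(\<And>s. a < s \<Longrightarrow> s < b \<Longrightarrow> g s = h s) \<Longrightarrow> action g a b = action h a b"
  unfolding action_def integral_open_interval_real
  by (intro Henstock_Kurzweil_Integration.integral_cong) (auto simp: rate_def)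

text \<open>The curve shifted to run ahead by \<open>h\<close> visits \<open>g (s + h)\<close> at time \<open>s\<close>. If \<open>f\<close> is Lipschitz in
  space, compare with the position \<open>g s\<close> at the same time, which is within \<open>h\<close>; if \<open>f\<close> is Lipschitz in
  time, compare with the same position at time \<open>s + h\<close>. Either way the integrands differ by at most \<open>Lf h\<close>,
  and the two intervals of integration by a piece of length \<open>h\<close>.\<close>

lemma action_shift_le:
  assumes g: "curve g" and h: "0 \<le> h" "0 \<le> t" "t + h < T"
  shows "action (\<lambda>s. g (s + h)) 0 t \<le> action g 0 (t + h) + (Lf * T + M) * h"
proof -
  have g': "curve (\<lambda>s. g (s + h))" using g by (rule lipschitz_curve_shift)
  have "Lf * h * t \<le> Lf * h * T" using h Lf_nonneg by (intro mult_left_mono) auto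
  then have K: "Lf * h * (t - 0) \<le> Lf * T * h" by (simp add: mult_ac)
  from f_lipschitz show ?thesis
  proof
    assume f: "\<forall>x y. \<forall>t\<in>{0<..<T}. \<bar>f (x, t) - f (y, t)\<bar> \<le> Lf * dist x y"
    have "rate (\<lambda>s. g (s + h)) s \<le> rate g s + Lf * h" if "0 < s" "s < t" for s
    proof -
      have "f (g (s + h), s) - f (g s, s) \<le> Lf * dist (g (s + h)) (g s)"
        using f that h by (simp add: abs_le_iff)
      also have "\<dots> \<le> Lf * h"
        using curve_dist_le[OF g, of "s + h" s] h Lf_nonneg by (intro mult_left_mono) auto
      finally show ?thesis using that h by (simp add: rate_def)
    qed
    then have "action (\<lambda>s. g (s + h)) 0 t \<le> action g 0 t + Lf * h * (t - 0)"
      unfolding action_def using h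
      by (intro integral_diff_le_of_open_bound rate_integrable g g') auto
    then show ?thesis
      using action_combine[OF g, of 0 t "t + h"] action_bounds(2)[OF g, of t "t + h"] h K
      by (simp add: algebra_simps)
  next
    assume f: "\<forall>x. \<forall>t\<in>{0<..<T}. \<forall>s\<in>{0<..<T}. \<bar>f (x, t) - f (x, s)\<bar> \<le> Lf * \<bar>t - s\<bar>"
    have "rate (\<lambda>s. g (s + h)) s \<le> (rate g \<circ> (+) h) s + Lf * h" if "0 < s" "s < t" for s
    proof -
      have "f (g (s + h), s) - f (g (s + h), s + h) \<le> Lf * h"
        using f[rule_format, of s "s + h" "g (s + h)"] that h by (simp add: abs_le_iff)
      then show ?thesis using that h by (simp add: rate_def add.commute)
    qed
    moreover have "(rate g \<circ> (+) h) integrable_on {0..t}"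
      using integrable_on_shift_cbox[of "rate g" h 0 t] rate_integrable[OF g] by simp
    ultimately have "action (\<lambda>s. g (s + h)) 0 t \<le>
        integral {0..t} (rate g \<circ> (+) h) + Lf * h * (t - 0)"
      unfolding action_def using h
      by (intro integral_diff_le_of_open_bound rate_integrable g') auto
    also have "integral {0..t} (rate g \<circ> (+) h) = action g h (t + h)"
      unfolding action_def by (simp add: integral_shift_Icc_real)
    finally show ?thesis
      using action_combine[OF g, of 0 h "t + h"] action_bounds(2)[OF g, of 0 h] h K
      by (simp add: algebra_simps)
  qed
qed

lemma cost_bounds:
  assumes "curve g" "0 \<le> t"
  shows "cost g t \<le> B + M * t" "- B - M * t \<le> cost g t"
  using action_bounds[OF assms] u0_bound[of "g 0"] by (auto simp: cost_def)

lemma val_le_cost: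
  assumes "curve g" "0 \<le> t"
  shows "val (g t) t \<le> cost g t"
  unfolding val_def
proof (rule cINF_lower)
  show "bdd_below ((\<lambda>h. cost h t) ` {h. curve h \<and> h t = g t})"
    using cost_bounds(2) assms(2) by (intro bdd_belowI2[where m = "- B - M * t"]) auto
qed (use assms in auto)

lemma near_optimal_curve:
  assumes "0 < \<epsilon>"
  obtains g where "curve g" "g t = x" "cost g t < val x t + \<epsilon>"
proof -
  have "(INF g\<in>{g. curve g \<and> g t = x}. cost g t) < val x t + \<epsilon>"
    using assms by (simp add: val_def)
  then have "\<exists>c\<in>(\<lambda>g. cost g t) ` {g. curve g \<and> g t = x}. c < val x t + \<epsilon>"
    using curve_const[of x] by (intro cInf_lessD) auto
  then show ?thesis using that by auto
qed

lemma val_initial: "val x 0 = u0 x"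
proof -
  have "cost g 0 = u0 (g 0)" for g by (simp add: cost_def action_def)
  then have "(\<lambda>g. cost g 0) ` {g. curve g \<and> g 0 = x} = {u0 x}"
    using curve_const[of x] by auto
  then show ?thesis by (simp add: val_def)
qed

lemma val_bound:
  assumes "0 \<le> t" "t < T"
  shows "\<bar>val x t\<bar> \<le> B + M * T"
proof -
  have MT: "M * t \<le> M * T" using assms M_nonneg by (intro mult_left_mono) auto
  have "val x t \<le> cost (\<lambda>_. x) t" using val_le_cost[OF curve_const] assms by simp
  moreover have "- B - M * t \<le> val x t"
    unfolding val_def using cost_bounds(2) assms(1) curve_const[of x]
    by (intro cINF_greatest) auto
  ultimately show ?thesis
    using cost_bounds(1)[OF curve_const, of t x] MT assms by (auto simp: abs_le_iff)
qed

text \<open>One half of the dynamic programming principle: follow a nearly optimal curve up to time \<open>s\<close>,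
  then switch to \<open>g\<close>.\<close>

lemma val_le_along_curve:
  assumes g: "curve g" and st: "0 \<le> s" "s \<le> t"
  shows "val (g t) t \<le> val (g s) s + action g s t"
proof (rule field_le_epsilon)
  fix e :: real assume "0 < e"
  then obtain h where h: "curve h" "h s = g s" "cost h s < val (g s) s + e"
    by (rule near_optimal_curve)
  define k where "k = (\<lambda>r. if r \<le> s then h r else g r)"
  have k: "curve k" unfolding k_def by (rule lipschitz_curve_concat[OF h(1) g h(2)])
  have "k t = g t" using st h(2) by (cases "s = t") (auto simp: k_def)
  then have "val (g t) t \<le> cost k t" using val_le_cost[OF k, of t] st by simp
  also have "cost k t = cost h s + action g s t"
  proof -
    have "action k 0 s = action h 0 s" "action k s t = action g s t"
      by (auto intro!: action_cong simp: k_def)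
    moreover have "k 0 = h 0" using st by (simp add: k_def)
    ultimately show ?thesis
      using action_combine[OF k, of 0 s t] st by (simp add: cost_def)
  qed
  finally show "val (g t) t \<le> val (g s) s + action g s t + e" using h(3) by simp
qed

lemma val_time_upper:
  assumes "0 \<le> t" "0 \<le> h"
  shows "val x (t + h) \<le> val x t + M * h"
  using val_le_along_curve[OF curve_const, of t "t + h" x]
    action_bounds(1)[OF curve_const, of t "t + h" x] assms by simp

text \<open>A Lipschitz constant in time, with room to dominate the other constants that occur.\<close>

definition K where "K = L0 + Lf * T + 2 * M"

lemma K_ge: "M \<le> K" "L0 \<le> K" "0 \<le> K" "L0 + (Lf * T + M) \<le> K" "L0 + M \<le> K"
proof -
  have "0 \<le> Lf * T" using Lf_nonneg T_pos by simp
  then show "M \<le> K" "L0 \<le> K" "0 \<le> K" "L0 + (Lf * T + M) \<le> K" "L0 + M \<le> K"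
    using M_nonneg L0_nonneg by (auto simp: K_def)
qed

text \<open>Omitting the first part of length \<open>h\<close> of a nearly optimal curve moves its starting point by at
  most \<open>h\<close>, and the shift changes the running cost by a multiple of \<open>h\<close>.\<close>

lemma val_time_lower:
  assumes "0 \<le> t" "0 \<le> h" "t + h < T"
  shows "val x t \<le> val x (t + h) + K * h"
proof (rule field_le_epsilon)
  fix e :: real assume "0 < e"
  then obtain g where g: "curve g" "g (t + h) = x" "cost g (t + h) < val x (t + h) + e"
    by (rule near_optimal_curve)
  have "val x t \<le> cost (\<lambda>s. g (s + h)) t"
    using val_le_cost[OF lipschitz_curve_shift[OF g(1)], of t h] assms g(2) by simp
  also have "\<dots> \<le> (u0 (g 0) + L0 * h) + (action g 0 (t + h) + (Lf * T + M) * h)"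
    unfolding cost_def using u0_le[of "g (0 + h)" "g 0" h] curve_dist_le[OF g(1), of "0 + h" 0] assms
    by (intro add_mono action_shift_le g(1)) auto
  also have "\<dots> = cost g (t + h) + (L0 + (Lf * T + M)) * h"
    by (simp add: cost_def algebra_simps)
  also have "\<dots> \<le> cost g (t + h) + K * h"
    using K_ge assms by (intro add_left_mono mult_right_mono) auto
  finally show "val x t \<le> val x (t + h) + K * h + e" using g(3) by simp
qed

lemma val_time_lipschitz:
  assumes "0 \<le> s" "s < T" "0 \<le> t" "t < T"
  shows "\<bar>val x t - val x s\<bar> \<le> K * \<bar>t - s\<bar>"
proof -
  have *: "\<bar>val x b - val x a\<bar> \<le> K * (b - a)" if "0 \<le> a" "a \<le> b" "b < T" for a b
  proof -
    have "M * (b - a) \<le> K * (b - a)" using K_ge that by (intro mult_right_mono) auto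
    then show ?thesis
      using val_time_upper[of a "b - a" x] val_time_lower[of a "b - a" x] that
      by (auto simp: abs_le_iff)
  qed
  show ?thesis using *[of s t] *[of t s] assms by (cases "s \<le> t") (auto simp: abs_minus_commute)
qed

text \<open>A curve through \<open>y\<close> can reach \<open>x\<close> at time \<open>t\<close> if it leaves \<open>y\<close> at time \<open>t - h\<close> with \<open>h > dist x y\<close>; the
  time regularity pays for the earlier departure. If \<open>t < h\<close>, both values are
  close to the initial ones, for which \<open>u0\<close> is Lipschitz.\<close>

lemma val_space_lipschitz:
  assumes t: "0 \<le> t" "t < T"
  shows "\<bar>val x t - val y t\<bar> \<le> 2 * K * dist x y"
proof -
  have strict: "val x t \<le> val y t + 2 * K * h" if xy: "dist y x < h" for x y h
  proof (cases "h \<le> t")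
    case True
    have h: "0 < h" using xy zero_le_dist[of y x] by linarith
    obtain g where g: "curve g" "g (t - h) = y" "g (t - h + h) = x"
      using lipschitz_curve_exists[OF length xy, of "t - h"] by blast
    have "val x t \<le> val y (t - h) + action g (t - h) t"
      using val_le_along_curve[OF g(1), of "t - h" t] g True h by simp
    also have "\<dots> \<le> (val y t + K * h) + K * h"
    proof (rule add_mono)
      show "val y (t - h) \<le> val y t + K * h"
        using val_time_lower[of "t - h" h y] True h t by simp
      have "M * h \<le> K * h" using K_ge h by (intro mult_right_mono) auto
      moreover have "action g (t - h) t \<le> M * h"
        using action_bounds(1)[OF g(1), of "t - h" t] h by simp
      ultimately show "action g (t - h) t \<le> K * h" by linarith
    qed
    finally show ?thesis by (simp add: algebra_simps)
  next
    case False
    have "val x t \<le> u0 x + M * t"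
      using val_time_upper[of 0 t x] t by (simp add: val_initial)
    also have "\<dots> \<le> (u0 y + L0 * h) + M * t"
      using u0_le[of x y h] xy by (simp add: dist_commute)
    finally have "val x t \<le> val y t + K * t + L0 * h + M * t"
      using val_time_lower[of 0 t y] t by (simp add: val_initial)
    moreover have "K * t \<le> K * h" "M * t \<le> M * h"
      using False K_ge M_nonneg by (auto intro!: mult_left_mono)
    moreover have "L0 * h + M * h \<le> K * h"
      unfolding distrib_right[symmetric] using False t K_ge by (intro mult_right_mono) auto
    ultimately show ?thesis by linarith
  qed
  have "val x t \<le> val y t + 2 * K * dist x y" for x y
  proof (rule field_le_epsilon)
    fix e :: real assume "0 < e"
    define h where "h = dist y x + e / (2 * K + 1)"
    have "val x t \<le> val y t + 2 * K * h"
      using K_ge \<open>0 < e\<close> by (intro strict) (simp add: h_def)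
    also have "2 * K * h \<le> 2 * K * dist x y + e"
    proof -
      have "2 * K * (e / (2 * K + 1)) = (2 * K / (2 * K + 1)) * e" by simp
      also have "\<dots> \<le> 1 * e" using K_ge \<open>0 < e\<close> by (intro mult_right_mono) auto
      finally show ?thesis by (simp add: h_def dist_commute algebra_simps)
    qed
    finally show "val x t \<le> val y t + 2 * K * dist x y + e" by simp
  qed
  from this[of x y] this[of y x] show ?thesis by (simp add: abs_le_iff dist_commute)
qed

lemma f_near:
  assumes "0 < t" "t < T" "0 < \<epsilon>"
  obtains r where "0 < r" "r \<le> t"
    "\<And>y s. dist x y < r \<Longrightarrow> t - r < s \<Longrightarrow> s \<le> t \<Longrightarrow> \<bar>f (y, s) - f (x, t)\<bar> \<le> \<epsilon>"
proof -
  obtain d where d: "0 < d" "\<And>q. q \<in> UNIV \<times> {0<..<T} \<Longrightarrow> dist q (x, t) < d \<Longrightarrow>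
      dist (f q) (f (x, t)) < \<epsilon>"
    using f_cont[unfolded continuous_on_iff, rule_format, of "(x, t)" \<epsilon>] assms by auto
  show ?thesis
  proof (rule that[of "min (d / 2) t"])
    fix y s assume ys: "dist x y < min (d / 2) t" "t - min (d / 2) t < s" "s \<le> t"
    have "dist (y, s) (x, t) \<le> dist y x + dist s t"
      unfolding dist_Pair_Pair by (rule sqrt_sum_squares_le_sum) auto
    also have "\<dots> < d" using ys by (auto simp: dist_commute dist_real_def min_def split: if_splits)
    finally have "dist (f (y, s)) (f (x, t)) < \<epsilon>"
      using ys assms by (intro d(2)) auto
    then show "\<bar>f (y, s) - f (x, t)\<bar> \<le> \<epsilon>" by (simp add: dist_real_def)
  qed (use d assms in auto)
qed

text \<open>When \<open>dist x y = \<delta>\<close> there may be no curve of speed one from \<open>y\<close> to \<open>x\<close> in time exactly \<open>\<delta>\<close>. A slightly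
  longer time \<open>l > \<delta>\<close> suffices for one, and continuity in time allows \<open>l\<close> to tend to \<open>\<delta>\<close>.\<close>

lemma val_slope_le:
  assumes t: "0 < t" "t < T"
  shows "slope_le (\<lambda>(x, t). val x t) (x, t) (f (x, t))"
  unfolding slope_le_def fst_conv snd_conv prod.case
proof (intro allI impI)
  fix \<epsilon> :: real assume eps: "0 < \<epsilon>"
  obtain r where r: "0 < r" "r \<le> t"
    "\<And>y s. dist x y < r \<Longrightarrow> t - r < s \<Longrightarrow> s \<le> t \<Longrightarrow> \<bar>f (y, s) - f (x, t)\<bar> \<le> \<epsilon>"
    using f_near[OF t eps] by blast
  have "val x t - val y (t - \<delta>) \<le> (f (x, t) + \<epsilon>) * \<delta>"
    if \<delta>: "0 < \<delta>" "\<delta> < r" "dist x y \<le> \<delta>" for \<delta> y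
  proof -
    have strict: "val x t \<le> val y (t - l) + (f (x, t) + \<epsilon>) * l" if l: "\<delta> < l" "l < r" for l
    proof -
      have "dist y x < l" using \<delta> l by (simp add: dist_commute)
      then obtain g where g: "curve g" "g (t - l) = y" "g (t - l + l) = x"
        using lipschitz_curve_exists[OF length] by blast
      have "rate g s \<le> f (x, t) + \<epsilon>" if s: "t - l < s" "s < t" for s
      proof -
        have "dist x (g s) < r"
          using curve_dist_le[OF g(1), of t s] g(3) s l by simp
        then have "\<bar>f (g s, s) - f (x, t)\<bar> \<le> \<epsilon>" using s l by (intro r(3)) auto
        moreover have "rate g s = f (g s, s)" using s l r(2) t by (simp add: rate_def)
        ultimately show ?thesis by linarith
      qed
      then have "action g (t - l) t \<le> (f (x, t) + \<epsilon>) * (t - (t - l))"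
        using l \<delta> by (intro action_le g(1)) auto
      then show ?thesis
        using val_le_along_curve[OF g(1), of "t - l" t] g l \<delta> r(2) by simp
    qed
    have "((\<lambda>l. val y (t - l) + (f (x, t) + \<epsilon>) * l) \<longlongrightarrow>
        val y (t - \<delta>) + (f (x, t) + \<epsilon>) * \<delta>) (at_right \<delta>)"
    proof (intro tendsto_intros)
      have "K-lipschitz_on {0..<T} (val y)"
        using val_time_lipschitz K_ge by (intro lipschitz_onI) (auto simp: dist_real_def)
      then have "continuous_on {0..<T} (val y)" by (rule lipschitz_on_continuous_on)
      then have "continuous_on {0<..<T} (val y)" by (rule continuous_on_subset) auto
      then have "isCont (val y) (t - \<delta>)"
        using \<delta> r(2) t by (simp add: continuous_on_eq_continuous_at)
      then show "((\<lambda>l. val y (t - l)) \<longlongrightarrow> val y (t - \<delta>)) (at_right \<delta>)"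
        by (rule isCont_tendsto_compose) (intro tendsto_intros)
    qed
    moreover have "\<forall>\<^sub>F l in at_right \<delta>. val x t \<le> val y (t - l) + (f (x, t) + \<epsilon>) * l"
      unfolding eventually_at_right_field using strict \<delta> by blast
    ultimately have "val x t \<le> val y (t - \<delta>) + (f (x, t) + \<epsilon>) * \<delta>"
      by (intro tendsto_lowerbound) auto
    then show ?thesis by simp
  qed
  then show "\<exists>r>0. \<forall>\<delta> y. 0 < \<delta> \<and> \<delta> < r \<and> dist x y \<le> \<delta> \<longrightarrow>
      val x t - val y (t - \<delta>) \<le> (f (x, t) + \<epsilon>) * \<delta>"
    using r(1) by blast
qed

text \<open>The backward step ends at the position that a nearly optimal curve had at time \<open>t - \<delta>\<close>. Its defect
  from optimality must be small compared with \<open>\<delta>\<close>, so the curve is chosen after \<open>\<delta>\<close>.\<close>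

lemma val_slope_ge:
  assumes t: "0 < t" "t < T"
  shows "slope_ge (\<lambda>(x, t). val x t) (x, t) (f (x, t))"
  unfolding slope_ge_def fst_conv snd_conv prod.case
proof (intro allI impI)
  fix \<epsilon> \<rho> :: real assume eps: "0 < \<epsilon>" and \<rho>: "0 < \<rho>"
  obtain r where r: "0 < r" "r \<le> t"
    "\<And>y s. dist x y < r \<Longrightarrow> t - r < s \<Longrightarrow> s \<le> t \<Longrightarrow> \<bar>f (y, s) - f (x, t)\<bar> \<le> \<epsilon> / 2"
    using f_near[OF t, of "\<epsilon> / 2"] eps by auto
  define \<delta> where "\<delta> = min \<rho> r / 2"
  have \<delta>: "0 < \<delta>" "\<delta> < \<rho>" "\<delta> < r" using r \<rho> by (auto simp: \<delta>_def)
  have "0 < \<epsilon> / 2 * \<delta>" using eps \<delta> by simp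
  then obtain g where g: "curve g" "g t = x" "cost g t < val x t + \<epsilon> / 2 * \<delta>"
    by (rule near_optimal_curve)
  have dist_g: "dist x (g s) \<le> t - s" if "s \<le> t" for s
    using curve_dist_le[OF g(1), of t s] g(2) that by simp
  have "f (x, t) - \<epsilon> / 2 \<le> rate g s" if s: "t - \<delta> < s" "s < t" for s
  proof -
    have "\<bar>f (g s, s) - f (x, t)\<bar> \<le> \<epsilon> / 2"
      using dist_g[of s] s \<delta> by (intro r(3)) auto
    moreover have "rate g s = f (g s, s)" using s \<delta> r(2) t by (simp add: rate_def)
    ultimately show ?thesis by linarith
  qed
  then have "(f (x, t) - \<epsilon> / 2) * (t - (t - \<delta>)) \<le> action g (t - \<delta>) t"
    using \<delta> by (intro action_ge g(1)) auto
  moreover have "val (g (t - \<delta>)) (t - \<delta>) + action g (t - \<delta>) t \<le> cost g t"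
    using val_le_cost[OF g(1), of "t - \<delta>"] action_combine[OF g(1), of 0 "t - \<delta>" t] \<delta> r(2)
    by (simp add: cost_def)
  ultimately have "(f (x, t) - \<epsilon>) * \<delta> \<le> val x t - val (g (t - \<delta>)) (t - \<delta>)"
    using g(3) by (simp add: algebra_simps)
  then show "\<exists>\<delta> y. 0 < \<delta> \<and> \<delta> < \<rho> \<and> dist x y \<le> \<delta> \<and>
      (f (x, t) - \<epsilon>) * \<delta> \<le> val x t - val y (t - \<delta>)"
    using \<delta> dist_g[of "t - \<delta>"] by (intro exI[of _ \<delta>] exI[of _ "g (t - \<delta>)"]) auto
qed

definition sol :: "'a \<times> real \<Rightarrow> real" where
  "sol = restrict (\<lambda>(x, t). val x t) (UNIV \<times> {0..<T})"

lemma sol_eq: "0 \<le> t \<Longrightarrow> t < T \<Longrightarrow> sol (x, t) = val x t"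
  by (simp add: sol_def)

lemma sol_extensional: "sol \<in> extensional (UNIV \<times> {0..<T})"
  by (simp add: sol_def)

lemma sol_bounded: "bounded (sol ` (UNIV \<times> {0..<T}))"
  using val_bound by (intro boundedI[where B = "B + M * T"]) (auto simp: sol_eq)

lemma sol_Lip: "sol \<in> st_Lip (UNIV \<times> {0..<T})"
proof -
  have "\<bar>val x t - val y s\<bar> \<le> 3 * K * st_dist (x, t) (y, s)"
    if "0 \<le> t" "t < T" "0 \<le> s" "s < T" for x y s t
  proof -
    let ?d = "st_dist (x, t) (y, s)"
    have "2 * K * dist x y \<le> 2 * K * ?d" "K * \<bar>t - s\<bar> \<le> K * ?d"
      using K_ge by (auto intro!: mult_left_mono simp: st_dist_def)
    then show ?thesis
      using val_space_lipschitz[of t x y] val_time_lipschitz[of s t y] that by linarith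
  qed
  then show ?thesis
    using K_ge unfolding st_Lip_def by (auto intro!: exI[of _ "3 * K"] simp: sol_eq)
qed

lemma sol_slope:
  assumes "p \<in> YT T"
  shows "slope_le sol p (f p)" "slope_ge sol p (f p)"
proof -
  obtain x t where p: "p = (x, t)" and t: "0 < t" "t < T"
    using assms by (auto simp: YT_def)
  have "slope_le sol p (f p) = slope_le (\<lambda>(x, t). val x t) p (f p)"
    "slope_ge sol p (f p) = slope_ge (\<lambda>(x, t). val x t) p (f p)"
    unfolding p by (rule slope_cong[where r = t]; use t in \<open>simp add: sol_eq\<close>)+
  then show "slope_le sol p (f p)" "slope_ge sol p (f p)"
    using val_slope_le val_slope_ge t by (auto simp: p)
qed

lemma sol_initial: "((\<lambda>t. SUP x. ereal \<bar>sol (x, t) - u0 x\<bar>) \<longlongrightarrow> 0) (at_right 0)"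
proof (rule tendsto_sandwich)
  have "(SUP x. ereal \<bar>sol (x, t) - u0 x\<bar>) \<le> ereal (K * t)" if "0 < t" "t < T" for t
    using val_time_lipschitz[of 0 t] that by (intro SUP_least) (auto simp: sol_eq val_initial)
  then show "\<forall>\<^sub>F t in at_right 0. (SUP x. ereal \<bar>sol (x, t) - u0 x\<bar>) \<le> ereal (K * t)"
    unfolding eventually_at_right_field using T_pos by blast
  show "\<forall>\<^sub>F t in at_right 0. 0 \<le> (SUP x. ereal \<bar>sol (x, t) - u0 x\<bar>)"
    by (intro always_eventually allI SUP_upper2[of undefined]) auto
  have "((\<lambda>t. K * t) \<longlongrightarrow> K * 0) (at_right 0)" by (intro tendsto_intros)
  then show "((\<lambda>t. ereal (K * t)) \<longlongrightarrow> 0) (at_right 0)"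
    by (simp add: zero_ereal_def)
qed simp

end

section \<open>Lipschitz Monge solutions\<close>

text \<open>The maximum metric is dominated by the product metric of the library, so Lipschitz continuity
  carries over with the same constant.\<close>

lemma st_Lip_imp_continuous_on:
  assumes "u \<in> st_Lip E"
  shows "continuous_on E u"
proof -
  obtain L where L: "L \<ge> 0" "\<And>p q. p \<in> E \<Longrightarrow> q \<in> E \<Longrightarrow> \<bar>u p - u q\<bar> \<le> L * st_dist p q"
    using assms by (auto simp: st_Lip_def)
  have le: "st_dist p q \<le> dist p q" for p q :: "'a \<times> real"
    unfolding st_dist_def using dist_fst_le[of p q] dist_snd_le[of p q] by (simp add: dist_real_def)
  have "L-lipschitz_on E u"
  proof (intro lipschitz_onI L(1))
    fix p q assume "p \<in> E" "q \<in> E"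
    then have "\<bar>u p - u q\<bar> \<le> L * st_dist p q" by (rule L)
    also have "\<dots> \<le> L * dist p q"
      using le L(1) by (rule mult_left_mono)
    finally show "dist (u p) (u q) \<le> L * dist p q" by (simp add: dist_real_def)
  qed
  then show ?thesis by (rule lipschitz_on_continuous_on)
qed

lemma st_Lip_imp_S_class:
  assumes "u \<in> st_Lip (UNIV \<times> {0..<T})"
  obtains k0 where "\<And>k. k0 \<le> k \<Longrightarrow> u \<in> S_class T k"
proof -
  obtain L where L: "0 \<le> L" "\<And>p q. p \<in> UNIV \<times> {0..<T} \<Longrightarrow> q \<in> UNIV \<times> {0..<T} \<Longrightarrow>
      \<bar>u p - u q\<bar> \<le> L * st_dist p q"
    using assms unfolding st_Lip_def by blast
  have "u \<in> S_class T k" if "L \<le> k" for k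
    unfolding S_class_def mem_Collect_eq
  proof (intro conjI allI impI)
    show "u \<in> st_Lip_loc (YT T)"
      unfolding st_Lip_loc_def
    proof (intro CollectI ballI exI[of _ "1 :: real"] conjI)
      show "u \<in> st_Lip {q \<in> YT T. st_dist z q < 1}" for z
        unfolding st_Lip_def
      proof (intro CollectI exI[of _ L] conjI ballI L)
        show "p \<in> {q \<in> YT T. st_dist z q < 1} \<Longrightarrow> p \<in> UNIV \<times> {0..<T}" for p
          by (auto simp: YT_def)
        then show "q \<in> {q \<in> YT T. st_dist z q < 1} \<Longrightarrow> q \<in> UNIV \<times> {0..<T}" for q .
      qed
    qed simp
    fix x s t assume st: "0 < s \<and> s < t \<and> t < T"
    have "\<bar>u (x, t) - u (x, s)\<bar> \<le> L * (t - s)"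
      using L(2)[of "(x, t)" "(x, s)"] st by (simp add: st_dist_def)
    also have "\<dots> \<le> k * (t - s)" using that st by (intro mult_right_mono) auto
    finally show "- k * (t - s) \<le> u (x, t) - u (x, s)" by (simp add: abs_le_iff)
  qed
  then show thesis using that by blast
qed

text \<open>The slope condition is independent of \<open>k\<close>, and the Lipschitz constant of \<open>u\<close> together with the
  bound on \<open>f\<close> shows that every large \<open>k\<close> is admissible.\<close>

lemma Monge_solution_iff_slope:
  fixes u f :: "'a::metric_space \<times> real \<Rightarrow> real"
  assumes u: "u \<in> st_Lip (UNIV \<times> {0..<T})" and f: "bounded (f ` YT T)"
  shows "Monge_solution T f u \<longleftrightarrow> (\<forall>p\<in>YT T. slope_le u p (f p) \<and> slope_ge u p (f p))"
proof
  assume "Monge_solution T f u"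
  then show "\<forall>p\<in>YT T. slope_le u p (f p) \<and> slope_ge u p (f p)"
    unfolding Monge_solution_def Dminus_add_time_eq_iff by blast
next
  assume slope: "\<forall>p\<in>YT T. slope_le u p (f p) \<and> slope_ge u p (f p)"
  obtain M where M: "\<And>p. p \<in> YT T \<Longrightarrow> \<bar>f p\<bar> \<le> M"
    using f unfolding bounded_iff by auto
  obtain k0 where k0: "\<And>k. k0 \<le> k \<Longrightarrow> u \<in> S_class T k"
    using st_Lip_imp_S_class[OF u] by blast
  define k where "k = max k0 (max M 0)"
  have "ereal (- k) \<le> (INF p\<in>YT T. ereal (f p))"
  proof (rule INF_greatest)
    fix p :: "'a \<times> real" assume "p \<in> YT T"
    then have "- k \<le> f p" using M[of p] by (auto simp: k_def)
    then show "ereal (- k) \<le> ereal (f p)" by simp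
  qed
  then have "ereal k + ereal (- k) \<le> ereal k + (INF p\<in>YT T. ereal (f p))"
    by (rule add_left_mono)
  then have "0 \<le> ereal k + (INF p\<in>YT T. ereal (f p))"
    by (simp add: zero_ereal_def)
  then show "Monge_solution T f u"
    unfolding Monge_solution_def Dminus_add_time_eq_iff
    using slope k0[of k] by (intro exI[of _ k]) (auto simp: k_def)
qed

lemma initial_value_of_uniform_limit:
  fixes u :: "'a::metric_space \<times> real \<Rightarrow> real"
  assumes "0 < T" and cont: "continuous_on (UNIV \<times> {0..<T}) u"
    and lim: "((\<lambda>t. SUP x. ereal \<bar>u (x, t) - u0 x\<bar>) \<longlongrightarrow> 0) (at_right 0)"
  shows "u (x, 0) = u0 x"
proof -
  have "((\<lambda>t. ereal \<bar>u (x, t) - u0 x\<bar>) \<longlongrightarrow> 0) (at_right 0)"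
    by (rule tendsto_sandwich[OF _ _ tendsto_const lim])
      (auto intro!: always_eventually SUP_upper)
  then have "((\<lambda>t. \<bar>u (x, t) - u0 x\<bar>) \<longlongrightarrow> 0) (at_right 0)"
    by (simp add: zero_ereal_def)
  then have "((\<lambda>t. u (x, t) - u0 x) \<longlongrightarrow> 0) (at_right 0)"
    by (rule tendsto_rabs_zero_cancel)
  then have l1: "((\<lambda>t. u (x, t)) \<longlongrightarrow> u0 x) (at_right 0)"
    by (simp add: LIM_zero_iff)
  have "continuous_on {0..T / 2} (\<lambda>t. u (x, t))"
    using \<open>0 < T\<close> by (intro continuous_on_compose2[OF cont] continuous_intros) auto
  then have "((\<lambda>t. u (x, t)) \<longlongrightarrow> u (x, 0)) (at 0 within {0..T / 2})"
    using \<open>0 < T\<close> by (auto simp: continuous_on_def)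
  then have l2: "((\<lambda>t. u (x, t)) \<longlongrightarrow> u (x, 0)) (at_right 0)"
    using \<open>0 < T\<close> by (simp add: at_within_Icc_at_right)
  show ?thesis using tendsto_unique[OF _ l2 l1] by simp
qed

theorem theorem1p1:
  fixes u0 :: "'a::complete_space \<Rightarrow> real"
    and f :: "'a \<times> real \<Rightarrow> real"
    and T Lf :: real
  assumes "length_space TYPE('a)"
    and "T > 0"
    and "bounded (range u0)"
    and "\<exists>L. L-lipschitz_on UNIV u0"
    and "continuous_on (UNIV \<times> {0<..<T}) f"
    and "bounded (f ` (UNIV \<times> {0<..<T}))"
    and "Lf > 0"
    and "(\<forall>x y. \<forall>t\<in>{0<..<T}. \<bar>f (x, t) - f (y, t)\<bar> \<le> Lf * dist x y) \<or>
         (\<forall>x. \<forall>t\<in>{0<..<T}. \<forall>s\<in>{0<..<T}. \<bar>f (x, t) - f (x, s)\<bar> \<le> Lf * \<bar>t - s\<bar>)"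
  shows "\<exists>!u. u \<in> extensional (UNIV \<times> {0..<T}) \<and>
           u \<in> st_Lip (UNIV \<times> {0..<T}) \<and>
           bounded (u ` (UNIV \<times> {0..<T})) \<and>
           Monge_solution T f u \<and>
           ((\<lambda>t. SUP x. ereal \<bar>u (x, t) - u0 x\<bar>) \<longlongrightarrow> 0) (at_right 0)"
proof (rule ex_ex1I)
  obtain L0 where "L0-lipschitz_on UNIV u0" using assms(4) by blast
  moreover obtain B where "\<And>x. \<bar>u0 x\<bar> \<le> B"
    using assms(3) unfolding bounded_iff by auto
  moreover obtain M where "\<forall>p\<in>UNIV \<times> {0<..<T}. \<bar>f p\<bar> \<le> M"
    using assms(6) unfolding bounded_iff by auto
  ultimately interpret eikonal_problem u0 f T B L0 M Lf
    using assms by unfold_locales auto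
  have "Monge_solution T f sol"
    using Monge_solution_iff_slope[OF sol_Lip] assms(6) sol_slope by (simp add: YT_def)
  then show "\<exists>u. u \<in> extensional (UNIV \<times> {0..<T}) \<and>
      u \<in> st_Lip (UNIV \<times> {0..<T}) \<and> bounded (u ` (UNIV \<times> {0..<T})) \<and> Monge_solution T f u \<and>
      ((\<lambda>t. SUP x. ereal \<bar>u (x, t) - u0 x\<bar>) \<longlongrightarrow> 0) (at_right 0)"
    using sol_extensional sol_Lip sol_bounded sol_initial by blast
next
  have le: "u (x, t) \<le> v (x, t)"
    if u: "u \<in> st_Lip (UNIV \<times> {0..<T})" "Monge_solution T f u"
        "((\<lambda>t. SUP x. ereal \<bar>u (x, t) - u0 x\<bar>) \<longlongrightarrow> 0) (at_right 0)"
      and v: "v \<in> st_Lip (UNIV \<times> {0..<T})" "Monge_solution T f v"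
        "((\<lambda>t. SUP x. ereal \<bar>v (x, t) - u0 x\<bar>) \<longlongrightarrow> 0) (at_right 0)"
      and t: "0 \<le> t" "t < T" for u v x t
  proof (rule Monge_comparison[where f = f and T = T])
    have f: "bounded (f ` YT T)" using assms(6) by (simp add: YT_def)
    show cont: "continuous_on (UNIV \<times> {0..<T}) u" "continuous_on (UNIV \<times> {0..<T}) v"
      using u(1) v(1) by (auto intro: st_Lip_imp_continuous_on)
    show "slope_le u p (f p)" "slope_ge v p (f p)" if "p \<in> YT T" for p
      using Monge_solution_iff_slope[OF u(1) f] Monge_solution_iff_slope[OF v(1) f] u(2) v(2) that
      by auto
    show "u (x, 0) \<le> v (x, 0)" for x
      using initial_value_of_uniform_limit[OF assms(2) cont(1) u(3), of x]
        initial_value_of_uniform_limit[OF assms(2) cont(2) v(3), of x] by simp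
  qed (use t in auto)
  fix u v
  assume u: "u \<in> extensional (UNIV \<times> {0..<T}) \<and>
      u \<in> st_Lip (UNIV \<times> {0..<T}) \<and> bounded (u ` (UNIV \<times> {0..<T})) \<and> Monge_solution T f u \<and>
      ((\<lambda>t. SUP x. ereal \<bar>u (x, t) - u0 x\<bar>) \<longlongrightarrow> 0) (at_right 0)"
    and v: "v \<in> extensional (UNIV \<times> {0..<T}) \<and>
      v \<in> st_Lip (UNIV \<times> {0..<T}) \<and> bounded (v ` (UNIV \<times> {0..<T})) \<and> Monge_solution T f v \<and>
      ((\<lambda>t. SUP x. ereal \<bar>v (x, t) - u0 x\<bar>) \<longlongrightarrow> 0) (at_right 0)"
  show "u = v"
  proof (rule extensionalityI)
    fix p :: "'a \<times> real" assume "p \<in> UNIV \<times> {0..<T}"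
    then obtain x t where "p = (x, t)" "0 \<le> t" "t < T" by auto
    then show "u p = v p" using le[of u v t x] le[of v u t x] u v by auto
  qed (use u v in auto)
qed

end
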